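(* Let $P$ be a convex equal-area polygon. A node of the affine distance symmetry set of $P$ that is not an endpoint is a cusp of the affine distance symmetry set if and only if it belongs to the affine evolute of $P$.
   Context: $[u,v]$ denotes the determinant of two plane vectors. A convex equal-area polygon $P$ is a simple polygon bounding a convex planar domain, with vertices $P_1,\dots,P_n\in\mathbb{R}^2$, $n\ge5$ (all indices modulo $n$) and oriented sides $\mathbf{v}_{i+\frac12}=P_{i+1}-P_i$, such that $[\mathbf{v}_{i-\frac12},\mathbf{v}_{i+\frac12}]=[\mathbf{v}_{i+\frac12},\mathbf{v}_{i+\frac32}]$ for every $i$; by an affine transformation this common determinant is normalized to be $1$. The affine normal vector at $P_i$ is $\mathbf{n}_i=\mathbf{v}_{i+\frac12}-\mathbf{v}_{i-\frac12}$, and the discrete affine curvature $\mu_{i+\frac12}$ is defined by $\mathbf{n}_{i+1}-\mathbf{n}_i=-\mu_{i+\frac12}\mathbf{v}_{i+\frac12}$. Parallels: for $\lambda\in\mathbb{R}$, the $\lambda$-parallel polygon $P(\lambda)$ has vertices $P_i(\lambda)=P_i+\lambda\mathbf{n}_i$ and edges $\mathbf{v}_{i+\frac12}(\lambda)=P_{i+1}(\lambda)-P_i(\lambda)=(1-\lambda\mu_{i+\frac12})\mathbf{v}_{i+\frac12}$. The vertex $P_i(\lambda)$ is a cusp of $P(\lambda)$ if $[\mathbf{v}_{i-\frac12},\mathbf{v}_{i+\frac12}]$ and $[\mathbf{v}_{i-\frac12}(\lambda),\mathbf{v}_{i+\frac12}(\lambda)]$ have different signs, equivalently $(1-\lambda\mu_{i-\frac12})(1-\lambda\mu_{i+\frac12})<0$.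 The normal line at $P_i$ is $\{P_i(\lambda):\lambda\in\mathbb{R}\}$. Affine evolute: the node $Q_{i+\frac12}$ is the intersection of the normal lines at $P_i$ and $P_{i+1}$, so $Q_{i+\frac12}=P_i+\frac1{\mu_{i+\frac12}}\mathbf{n}_i=P_{i+1}+\frac1{\mu_{i+\frac12}}\mathbf{n}_{i+1}$. The edge $\mathbf{e}_i$ is the subset of the normal line at $P_i$ with boundary $\{Q_{i-\frac12},Q_{i+\frac12}\}$ that does not contain $P_i$: the segment $\overline{Q_{i-\frac12}Q_{i+\frac12}}$ if $\mu_{i-\frac12}\mu_{i+\frac12}>0$, the complement of this segment if $\mu_{i-\frac12}\mu_{i+\frac12}<0$, and a half-line if $\mu_{i-\frac12}$ or $\mu_{i+\frac12}$ is zero. The affine evolute is the graph with nodes $Q_{i+\frac12}$ and edges $\mathbf{e}_i$. Affine distance symmetry set (ADSS): the closure of the set of points $X$ such that there exist two edges $\mathbf{v}_{i+\frac12}$ and $\mathbf{v}_{j+\frac12}$, $|i-j|\ge2$, and $\lambda\in\mathbb{R}$ such that the edges $\mathbf{v}_{i+\frac12}(\lambda)$ and $\mathbf{v}_{j+\frac12}(\lambda)$ of $P(\lambda)$ intersect at $X$. The points of the ADSS associated with $\mathbf{v}_{i+\frac12}$ and $\mathbf{v}_{j+\frac12}$ form a segment denoted $\mathbf{h}(i+\frac12,j+\frac12)$, an edge of the ADSS. A node of the ADSS belongs to a normal line at some vertex $P_i$; it is an endpoint of the ADSS if it is connected to only one edge $\mathbf{h}(i-\frac12,i+\frac32)$,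 and otherwise it is a common vertex, denoted $M_{i,j+\frac12}$, of $\mathbf{h}(i-\frac12,j+\frac12)$ and $\mathbf{h}(i+\frac12,j+\frac12)$. A node $M_{i,j+\frac12}$ that is not an endpoint is, for a certain $\lambda$, at the boundary of both $\mathbf{v}_{i-\frac12}(\lambda)$ and $\mathbf{v}_{i+\frac12}(\lambda)$, and also belongs to $\mathbf{v}_{j+\frac12}(\lambda)$. It is called a cusp of the ADSS if it is a cusp of the parallel $P(\lambda)$, which is equivalent to the edges $\mathbf{v}_{i-\frac12}(\lambda)$ and $\mathbf{v}_{i+\frac12}(\lambda)$ being on the same side of the normal line at $P_i$.
   Formalization: A node is shown to be a cusp iff it lies on the evolute edge of its own normal line; for the whole evolute it is assumed that the node lies on no evolute edge of another normal line. A node where an adjacent edge of the parallel collapses to a point counts as a cusp. *)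

theory Defs
  imports "HOL-Analysis.Analysis"
begin

text \<open>
  A polygon with \<open>n\<close> vertices is an \<open>n\<close>-periodic map from the integers to the plane. An object with
  half-integer index \<open>i + 1/2\<close> (side, curvature, evolute node) is indexed here by the integer \<open>i\<close>;
  \<open>i - 1/2\<close> becomes \<open>i - 1\<close>.
\<close>

type_synonym polygon = "int \<Rightarrow> real ^ 2"

definition det2 :: "real ^ 2 \<Rightarrow> real ^ 2 \<Rightarrow> real" where
  "det2 u v = det (vector [u, v] :: real ^ 2 ^ 2)"

text \<open>The condition \<open>\<bar>i - j\<bar> \<ge> 2\<close>, read cyclically: the sides \<open>i\<close> and \<open>j\<close> are distinct and do not
  share a vertex.\<close>

definition nonadjacent :: "nat \<Rightarrow> int \<Rightarrow> int \<Rightarrow> bool" where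
  "nonadjacent n i j \<longleftrightarrow> 2 \<le> (i - j) mod int n \<and> (i - j) mod int n \<le> int n - 2"


subsection \<open>Convex equal-area polygons\<close>

definition side :: "polygon \<Rightarrow> int \<Rightarrow> real ^ 2" where
  "side P i = P (i + 1) - P i"

definition polygon_curve :: "polygon \<Rightarrow> (real ^ 2) set" where
  "polygon_curve P = (\<Union>i. closed_segment (P i) (P (i + 1)))"

definition simple_polygon :: "nat \<Rightarrow> polygon \<Rightarrow> bool" where
  "simple_polygon n P \<longleftrightarrow>
     (\<forall>i. P (i + int n) = P i) \<and>
     (\<forall>i. closed_segment (P (i - 1)) (P i) \<inter> closed_segment (P i) (P (i + 1)) = {P i}) \<and>
     (\<forall>i j. nonadjacent n i j \<longrightarrow>
        closed_segment (P i) (P (i + 1)) \<inter> closed_segment (P j) (P (j + 1)) = {})"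

definition convex_equal_area_polygon :: "nat \<Rightarrow> polygon \<Rightarrow> bool" where
  "convex_equal_area_polygon n P \<longleftrightarrow>
     n \<ge> 5 \<and> simple_polygon n P \<and> convex (inside (polygon_curve P)) \<and>
     (\<forall>i. det2 (side P (i - 1)) (side P i) = 1)"

definition affine_normal :: "polygon \<Rightarrow> int \<Rightarrow> real ^ 2" where
  "affine_normal P i = side P i - side P (i - 1)"

definition affine_curvature :: "polygon \<Rightarrow> int \<Rightarrow> real" where
  "affine_curvature P i =
     (THE m. affine_normal P (i + 1) - affine_normal P i = - m *\<^sub>R side P i)"


subsection \<open>Parallels\<close>

definition parallel :: "polygon \<Rightarrow> real \<Rightarrow> polygon" where
  "parallel P l i = P i + l *\<^sub>R affine_normal P i"

definition parallel_edge :: "polygon \<Rightarrow> real \<Rightarrow> int \<Rightarrow> (real ^ 2) set" where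
  "parallel_edge P l i = closed_segment (parallel P l i) (parallel P l (i + 1))"

definition normal_line :: "polygon \<Rightarrow> int \<Rightarrow> (real ^ 2) set" where
  "normal_line P i = range (\<lambda>l. parallel P l i)"

text \<open>The sign is three-valued: if one of the two sides of the parallel collapses to a point, its
  determinant is \<open>0\<close> and the signs count as different. This matches the evolute edges below being
  closed, i.e. containing their nodes. See \<open>parallel_cusp_iff\<close> for the other case.\<close>

definition parallel_cusp :: "polygon \<Rightarrow> real \<Rightarrow> int \<Rightarrow> bool" where
  "parallel_cusp P l i \<longleftrightarrow>
     sgn (det2 (side P (i - 1)) (side P i)) \<noteq>
     sgn (det2 (side (parallel P l) (i - 1)) (side (parallel P l) i))"


subsection \<open>Affine evolute\<close>

text \<open>The node exists only if the curvature is nonzero; for zero curvature the value is irrelevant.\<close>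

definition evolute_node :: "polygon \<Rightarrow> int \<Rightarrow> real ^ 2" where
  "evolute_node P i = P i + (1 / affine_curvature P i) *\<^sub>R affine_normal P i"

text \<open>If exactly one of the two curvatures vanishes, the edge is the half-line on the normal line that
  starts at the only node and points away from \<open>P i\<close>; if both vanish, there is no node to bound
  an edge.\<close>

definition evolute_edge :: "polygon \<Rightarrow> int \<Rightarrow> (real ^ 2) set" where
  "evolute_edge P i =
    (let a = affine_curvature P (i - 1); b = affine_curvature P i;
         Qa = evolute_node P (i - 1); Qb = evolute_node P i
     in if a * b > 0 then closed_segment Qa Qb
        else if a * b < 0 then normal_line P i - open_segment Qa Qb
        else if a \<noteq> 0 then {Qa + t *\<^sub>R (Qa - P i) | t. 0 \<le> t}
        else if b \<noteq> 0 then {Qb + t *\<^sub>R (Qb - P i) | t. 0 \<le> t}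
        else {})"

definition affine_evolute :: "polygon \<Rightarrow> (real ^ 2) set" where
  "affine_evolute P =
     {evolute_node P i | i. affine_curvature P i \<noteq> 0} \<union> (\<Union>i. evolute_edge P i)"


subsection \<open>Affine distance symmetry set\<close>

definition adss :: "nat \<Rightarrow> polygon \<Rightarrow> (real ^ 2) set" where
  "adss n P = closure {X. \<exists>i j l. nonadjacent n i j \<and> X \<in> parallel_edge P l i \<inter> parallel_edge P l j}"

definition adss_edge :: "polygon \<Rightarrow> int \<Rightarrow> int \<Rightarrow> (real ^ 2) set" where
  "adss_edge P i j = closure {X. \<exists>l. X \<in> parallel_edge P l i \<inter> parallel_edge P l j}"

text \<open>The position \<open>X\<close> of a node is recorded together with the vertex \<open>i\<close> on whose normal line it
  lies and the side \<open>j\<close> that it meets; the edges of the symmetry set at this node are the ones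
  associated with \<open>j\<close> and with one of the sides \<open>i - 1\<close>, \<open>i\<close> at the vertex \<open>i\<close>.\<close>

definition incident_sides :: "nat \<Rightarrow> polygon \<Rightarrow> int \<Rightarrow> int \<Rightarrow> real ^ 2 \<Rightarrow> int set" where
  "incident_sides n P i j X = {k \<in> {i - 1, i}. nonadjacent n k j \<and> X \<in> adss_edge P k j}"

definition adss_node :: "nat \<Rightarrow> polygon \<Rightarrow> int \<Rightarrow> int \<Rightarrow> real ^ 2 \<Rightarrow> bool" where
  "adss_node n P i j X \<longleftrightarrow>
     X \<in> adss n P \<and> incident_sides n P i j X \<noteq> {} \<and>
     (\<exists>l. X = parallel P l i \<and> X \<in> parallel_edge P l j)"

definition adss_endpoint :: "nat \<Rightarrow> polygon \<Rightarrow> int \<Rightarrow> int \<Rightarrow> real ^ 2 \<Rightarrow> bool" where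
  "adss_endpoint n P i j X \<longleftrightarrow> adss_node n P i j X \<and> card (incident_sides n P i j X) = 1"

definition adss_cusp :: "polygon \<Rightarrow> int \<Rightarrow> int \<Rightarrow> real ^ 2 \<Rightarrow> bool" where
  "adss_cusp P i j X \<longleftrightarrow>
     (\<exists>l. X = parallel P l i \<and> X \<in> parallel_edge P l j \<and> parallel_cusp P l i)"


subsection \<open>Basic facts\<close>

lemma det2_eq: "det2 u v = u $ 1 * v $ 2 - u $ 2 * v $ 1"
  by (simp add: det2_def det_2)

lemma affine_curvature_eq:
  assumes "convex_equal_area_polygon n P"
  shows "affine_normal P (i + 1) - affine_normal P i = - affine_curvature P i *\<^sub>R side P i"
proof -
  let ?u = "side P (i - 1)" and ?v = "side P i" and ?w = "side P (i + 1)"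
  have uv: "det2 ?u ?v = 1" and vw: "det2 ?v ?w = 1"
    using assms spec[of "\<lambda>i. det2 (side P (i - 1)) (side P i) = 1" "i + 1"]
    by (simp_all add: convex_equal_area_polygon_def)
  have ne: "?v \<noteq> 0" using uv by (auto simp: det2_eq)
  have par: "affine_normal P (i + 1) - affine_normal P i = - (2 - det2 ?u ?w) *\<^sub>R ?v"
  proof -
    have sum: "a + e = (a * f - b * e) * c \<and> b + f = (a * f - b * e) * d"
      if "a * d - b * c = 1" "c * f - d * e = 1" for a b c d e f :: real
    proof -
      have "(a * f - b * e) * c = a * (c * f - d * e) + e * (a * d - b * c)"
        "(a * f - b * e) * d = b * (c * f - d * e) + f * (a * d - b * c)"
        by (simp_all add: algebra_simps)
      with that show ?thesis by simp
    qed
    have "?u $ 1 + ?w $ 1 = det2 ?u ?w * ?v $ 1 \<and> ?u $ 2 + ?w $ 2 = det2 ?u ?w * ?v $ 2"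
      using sum uv vw unfolding det2_eq by blast
    then have "?w + ?u = det2 ?u ?w *\<^sub>R ?v"
      by (simp add: vec_eq_iff forall_2 add.commute)
    moreover have "affine_normal P (i + 1) - affine_normal P i = ?w + ?u - 2 *\<^sub>R ?v"
      by (simp add: affine_normal_def scaleR_2)
    ultimately show ?thesis
      by (simp add: scaleR_left_diff_distrib)
  qed
  have "affine_curvature P i = 2 - det2 ?u ?w"
    unfolding affine_curvature_def
  proof (rule the_equality)
    show "affine_normal P (i + 1) - affine_normal P i = - (2 - det2 ?u ?w) *\<^sub>R ?v"
      by (fact par)
    fix m
    assume "affine_normal P (i + 1) - affine_normal P i = - m *\<^sub>R ?v"
    with par have "m *\<^sub>R ?v = (2 - det2 ?u ?w) *\<^sub>R ?v"
      by (metis add.inverse_inverse scaleR_minus_left)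
    then show "m = 2 - det2 ?u ?w" using ne by (metis scaleR_right_imp_eq)
  qed
  with par show ?thesis by simp
qed

lemma side_parallel:
  assumes "convex_equal_area_polygon n P"
  shows "side (parallel P l) i = (1 - l * affine_curvature P i) *\<^sub>R side P i"
proof -
  have "side (parallel P l) i = side P i + l *\<^sub>R (affine_normal P (i + 1) - affine_normal P i)"
    by (simp add: side_def parallel_def algebra_simps)
  then show ?thesis
    unfolding affine_curvature_eq[OF assms] by (simp add: scaleR_left_diff_distrib)
qed

lemma parallel_cusp_iff:
  assumes "convex_equal_area_polygon n P"
    and "side (parallel P l) (i - 1) \<noteq> 0" "side (parallel P l) i \<noteq> 0"
  shows "parallel_cusp P l i \<longleftrightarrow>
    (1 - l * affine_curvature P (i - 1)) * (1 - l * affine_curvature P i) < 0"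
proof -
  have "det2 (side P (i - 1)) (side P i) = 1"
    using assms(1) by (simp add: convex_equal_area_polygon_def)
  moreover have "det2 (side (parallel P l) (i - 1)) (side (parallel P l) i) =
      (1 - l * affine_curvature P (i - 1)) * (1 - l * affine_curvature P i) *
      det2 (side P (i - 1)) (side P i)"
    by (simp add: side_parallel[OF assms(1)] det2_eq algebra_simps)
  moreover have "(1 - l * affine_curvature P (i - 1)) * (1 - l * affine_curvature P i) \<noteq> 0"
    using assms(2,3) by (auto simp: side_parallel[OF assms(1)])
  moreover have "sgn 1 \<noteq> sgn d \<longleftrightarrow> d < 0" if "d \<noteq> 0" for d :: real
    using that by (cases "d > 0") auto
  ultimately show ?thesis
    unfolding parallel_cusp_def by (metis mult_1_right)
qed

lemma normal_lines_meet:
  assumes "convex_equal_area_polygon n P" "affine_curvature P i \<noteq> 0"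
  shows "normal_line P i \<inter> normal_line P (i + 1) = {evolute_node P i}"
proof -
  let ?m = "affine_curvature P i" and ?v = "side P i"
  have "det2 (side P (i + 1 - 1)) (side P (i + 1)) = 1"
    using assms(1) unfolding convex_equal_area_polygon_def by blast
  then have vw: "det2 ?v (side P (i + 1)) = 1" by simp
  have ne: "?v \<noteq> 0" using vw by (auto simp: det2_eq)
  have diff: "parallel P k (i + 1) - parallel P l i =
      (1 - l * ?m) *\<^sub>R ?v + (k - l) *\<^sub>R affine_normal P (i + 1)" for k l
  proof -
    have "parallel P k (i + 1) - parallel P l i =
        side (parallel P l) i + (k - l) *\<^sub>R affine_normal P (i + 1)"
      by (simp add: side_def parallel_def algebra_simps)
    then show ?thesis by (simp add: side_parallel[OF assms(1)])
  qed
  have "l * ?m = 1" if eq: "parallel P k (i + 1) = parallel P l i" for k l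
  proof -
    have 0: "(1 - l * ?m) *\<^sub>R ?v + (k - l) *\<^sub>R affine_normal P (i + 1) = 0"
      using diff[of k l] eq by simp
    have "0 = det2 ?v ((1 - l * ?m) *\<^sub>R ?v + (k - l) *\<^sub>R affine_normal P (i + 1))"
      by (simp only: 0) (simp add: det2_eq)
    also have "\<dots> = (k - l) * det2 ?v (side P (i + 1))"
      by (simp add: det2_eq affine_normal_def algebra_simps)
    finally have "k = l" using vw by simp
    with 0 ne show ?thesis by simp
  qed
  then have l: "l = 1 / ?m" if "parallel P k (i + 1) = parallel P l i" for k l
    using that assms(2) by (simp add: field_simps)
  have meet: "parallel P (1 / ?m) (i + 1) = parallel P (1 / ?m) i"
    using diff[of "1 / ?m" "1 / ?m"] assms(2) by simp
  have node: "evolute_node P i = parallel P (1 / ?m) i"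
    by (simp add: evolute_node_def parallel_def)
  show ?thesis
  proof (intro equalityI subsetI)
    fix X
    assume "X \<in> normal_line P i \<inter> normal_line P (i + 1)"
    then obtain k l' where "X = parallel P l' i" "X = parallel P k (i + 1)"
      unfolding normal_line_def by blast
    with l[of k l'] node show "X \<in> {evolute_node P i}" by simp
  next
    fix X
    assume "X \<in> {evolute_node P i}"
    then have "X = parallel P (1 / ?m) i" "X = parallel P (1 / ?m) (i + 1)"
      using node meet by simp_all
    then show "X \<in> normal_line P i \<inter> normal_line P (i + 1)"
      unfolding normal_line_def by blast
  qed
qed

end

(*
  The affine normal at P_i is nonzero, so a point X of the normal line at P_i is P_i(l) for a
  unique l, and the conditions on X become conditions on l. With a and b the curvatures of the two
  sides at P_i, the vertex P_i(l) is a cusp of the parallel iff (1 - l a) (1 - l b) <= 0. The two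
  evolute nodes on the normal line have the parameters 1/a and 1/b, and in each case of the
  definition of the evolute edge at P_i the same inequality describes its points.
*)

theory Submission
  imports Defs
begin

lemma affine_normal_nonzero:
  assumes "convex_equal_area_polygon n P"
  shows "affine_normal P i \<noteq> 0"
proof
  assume "affine_normal P i = 0"
  then have "det2 (side P (i - 1)) (side P i) = 0"
    by (simp add: affine_normal_def det2_eq)
  with assms show False
    by (simp add: convex_equal_area_polygon_def)
qed

lemma parallel_inject:
  assumes "convex_equal_area_polygon n P"
  shows "parallel P l i = parallel P l' i \<longleftrightarrow> l = l'"
  using affine_normal_nonzero[OF assms] by (simp add: parallel_def)

text \<open>Each side of the parallel is the original side times \<open>1 - l * \<mu>\<close>, so
  the determinant at the vertex is the product of two such factors. The inequality is not strict
  because a collapsed side has determinant 0, whose sign differs from 1.\<close>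

lemma parallel_cusp_iff_le:
  assumes "convex_equal_area_polygon n P"
  shows "parallel_cusp P l i \<longleftrightarrow>
    (1 - l * affine_curvature P (i - 1)) * (1 - l * affine_curvature P i) \<le> 0"
proof -
  let ?c = "(1 - l * affine_curvature P (i - 1)) * (1 - l * affine_curvature P i)"
  have 1: "det2 (side P (i - 1)) (side P i) = 1"
    using assms by (simp add: convex_equal_area_polygon_def)
  have "det2 (side (parallel P l) (i - 1)) (side (parallel P l) i) =
      ?c * det2 (side P (i - 1)) (side P i)"
    by (simp add: side_parallel[OF assms] det2_eq algebra_simps)
  then have "parallel_cusp P l i \<longleftrightarrow> sgn ?c \<noteq> 1"
    using 1 by (auto simp: parallel_cusp_def)
  then show ?thesis
    by (simp add: sgn_1_pos not_less)
qed

lemma evolute_node_eq_parallel: "evolute_node P i = parallel P (1 / affine_curvature P i) i"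
  by (simp add: evolute_node_def parallel_def)

text \<open>The node is defined from the vertex \<open>i - 1\<close>. At its parameter the side
  \<open>i - 1\<close> of the parallel collapses, so the same point also has that parameter on the
  normal line at \<open>i\<close>.\<close>

lemma evolute_node_prev_eq_parallel:
  assumes "convex_equal_area_polygon n P" "affine_curvature P (i - 1) \<noteq> 0"
  shows "evolute_node P (i - 1) = parallel P (1 / affine_curvature P (i - 1)) i"
proof -
  let ?l = "1 / affine_curvature P (i - 1)"
  have "side (parallel P ?l) (i - 1) = 0"
    using assms by (simp add: side_parallel)
  then show ?thesis
    by (simp add: side_def evolute_node_eq_parallel)
qed

lemma parallel_affine_combination:
  "(1 - t) *\<^sub>R parallel P a i + t *\<^sub>R parallel P b i = parallel P ((1 - t) * a + t * b) i"
  by (simp add: parallel_def algebra_simps)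

text \<open>The map from \<open>l\<close> to \<open>parallel P l i\<close> is affine and injective,
  so betweenness on the normal line is betweenness of parameters.\<close>

lemma parallel_in_closed_segment:
  assumes "convex_equal_area_polygon n P"
  shows "parallel P l i \<in> closed_segment (parallel P a i) (parallel P b i) \<longleftrightarrow>
    l \<in> closed_segment a b"
  by (auto simp: in_segment parallel_affine_combination parallel_inject[OF assms])

lemma parallel_in_open_segment:
  assumes "convex_equal_area_polygon n P"
  shows "parallel P l i \<in> open_segment (parallel P a i) (parallel P b i) \<longleftrightarrow>
    l \<in> open_segment a b"
  by (simp add: open_segment_def parallel_in_closed_segment[OF assms] parallel_inject[OF assms])

lemma in_closed_segment_iff_prod_le_0:
  fixes x a b :: real
  shows "x \<in> closed_segment a b \<longleftrightarrow> (x - a) * (x - b) \<le> 0"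
  by (auto simp: closed_segment_eq_real_ivl mult_le_0_iff)

lemma in_open_segment_iff_prod_less_0:
  fixes x a b :: real
  shows "x \<in> open_segment a b \<longleftrightarrow> (x - a) * (x - b) < 0"
  by (auto simp: open_segment_eq_real_ivl mult_less_0_iff)

lemma parallel_in_ray_from_node:
  assumes "convex_equal_area_polygon n P" "c \<noteq> 0"
  shows "parallel P l i \<in> {parallel P (1 / c) i + t *\<^sub>R (parallel P (1 / c) i - P i) | t. 0 \<le> t}
    \<longleftrightarrow> 1 - l * c \<le> 0"
proof -
  \<comment> \<open>The ray is followed in parameters: its origin has parameter
    \<open>1 / c\<close>, and \<open>P i\<close> has parameter 0.\<close>
  have "parallel P (1 / c) i + t *\<^sub>R (parallel P (1 / c) i - P i) = parallel P ((1 + t) / c) i" for t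
    by (simp add: parallel_def algebra_simps add_divide_distrib)
  moreover have "(\<exists>t\<ge>0. l = (1 + t) / c) \<longleftrightarrow> 1 - l * c \<le> 0"
  proof
    assume "1 - l * c \<le> 0"
    then show "\<exists>t\<ge>0. l = (1 + t) / c"
      using assms(2) by (intro exI[of _ "l * c - 1"]) auto
  qed (use assms(2) in auto)
  ultimately show ?thesis
    by (auto simp: parallel_inject[OF assms(1)])
qed

text \<open>The cases are those of the definition of the edge: for two nodes, the sign of
  \<open>a * b\<close> decides between a segment and its complement; a zero curvature turns one
  factor into 1.\<close>

lemma parallel_in_evolute_edge:
  assumes "convex_equal_area_polygon n P"
  shows "parallel P l i \<in> evolute_edge P i \<longleftrightarrow>
    (1 - l * affine_curvature P (i - 1)) * (1 - l * affine_curvature P i) \<le> 0"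
proof -
  define a where "a = affine_curvature P (i - 1)"
  define b where "b = affine_curvature P i"
  have Qa: "evolute_node P (i - 1) = parallel P (1 / a) i" if "a \<noteq> 0"
    using evolute_node_prev_eq_parallel[OF assms] that by (simp add: a_def)
  have Qb: "evolute_node P i = parallel P (1 / b) i"
    by (simp add: evolute_node_eq_parallel b_def)
  have prod: "(1 - l * a) * (1 - l * b) = (a * b) * ((l - 1 / a) * (l - 1 / b))"
    if "a * b \<noteq> 0"
    using that by (simp add: field_simps)
  note edge = evolute_edge_def Let_def a_def[symmetric] b_def[symmetric]
  consider "a * b > 0" | "a * b < 0" | "a \<noteq> 0" "b = 0" | "a = 0" "b \<noteq> 0" | "a = 0" "b = 0"
    by (metis linorder_neqE_linordered_idom mult_eq_0_iff)
  then show ?thesis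
  proof cases
    case 1
    then have "(1 - l * a) * (1 - l * b) \<le> 0 \<longleftrightarrow> (l - 1 / a) * (l - 1 / b) \<le> 0"
      unfolding prod[OF less_imp_neq[OF 1, symmetric]] mult_le_0_iff[of "a * b"] by auto
    moreover have "a \<noteq> 0" using 1 by auto
    ultimately show ?thesis
      using 1 by (simp add: edge Qa Qb parallel_in_closed_segment[OF assms]
          in_closed_segment_iff_prod_le_0)
  next
    case 2
    \<comment> \<open>Dividing by the negative \<open>a * b\<close> reverses the inequality, which
      gives the complement of the open segment, nodes included.\<close>
    then have "(1 - l * a) * (1 - l * b) \<le> 0 \<longleftrightarrow> \<not> (l - 1 / a) * (l - 1 / b) < 0"
      unfolding prod[OF less_imp_neq[OF 2]] mult_le_0_iff[of "a * b"] by auto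
    moreover have "a \<noteq> 0" using 2 by auto
    ultimately show ?thesis
      using 2 by (simp add: edge Qa Qb parallel_in_open_segment[OF assms]
          in_open_segment_iff_prod_less_0 normal_line_def)
  next
    case 3
    then show ?thesis
      using parallel_in_ray_from_node[OF assms, of a l i] by (simp add: edge Qa)
  next
    case 4
    then show ?thesis
      using parallel_in_ray_from_node[OF assms, of b l i] by (simp add: edge Qb)
  next
    case 5
    then show ?thesis by (simp add: edge)
  qed
qed

text \<open>At \<open>l = 1 / \<mu>\<close> one factor of the product vanishes. Hence the nodes add
  nothing to the union of the edges.\<close>

lemma evolute_node_in_edge:
  assumes "convex_equal_area_polygon n P" "affine_curvature P i \<noteq> 0"
  shows "evolute_node P i \<in> evolute_edge P i"
  using assms by (simp add: evolute_node_eq_parallel parallel_in_evolute_edge)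

lemma periodic_cong:
  fixes P :: "int \<Rightarrow> 'a" and N :: int
  assumes per: "\<And>i. P (i + N) = P i" and "k mod N = i mod N"
  shows "P k = P i"
proof -
  have nat_shift: "P (i + int m * N) = P i" for i m
  proof (induction m)
    case (Suc m)
    have "P (i + int (Suc m) * N) = P (i + int m * N + N)"
      by (simp add: algebra_simps)
    with Suc per show ?case by simp
  qed simp
  have shift: "P (i + d * N) = P i" for i d
  proof (cases "d \<ge> 0")
    case True
    then show ?thesis using nat_shift[of i "nat d"] by simp
  next
    case False
    \<comment> \<open>For negative \<open>d\<close>, the forward shift by \<open>- d\<close> periods
      starts at \<open>i + d * N\<close> and ends at \<open>i\<close>.\<close>
    then show ?thesis using nat_shift[of "i + d * N" "nat (- d)"] by simp
  qed
  have "N dvd k - i"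
    using assms(2) by (simp add: mod_eq_dvd_iff)
  then obtain d where "k = i + d * N"
    by (metis dvdE mult.commute diff_eq_eq add.commute)
  with shift show ?thesis by simp
qed

text \<open>Indices run over all integers, so each geometric edge occurs once for every index in a
  residue class.\<close>

lemma evolute_edge_cong:
  assumes "\<And>i. P (i + N) = P i" and "k mod N = i mod N"
  shows "evolute_edge P k = evolute_edge P i"
proof -
  \<comment> \<open>The offset \<open>d\<close> is kept general because normals, curvatures and
    nodes also involve neighbouring indices.\<close>
  have P: "P (k + d) = P (i + d)" for d
    by (rule periodic_cong[of P N, OF assms(1)]) (rule mod_add_cong[OF assms(2) refl])
  have side: "side P (k + d) = side P (i + d)" for d
    using P[of "d + 1"] P[of d] by (simp add: side_def add.assoc)
  have normal: "affine_normal P (k + d) = affine_normal P (i + d)" for d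
    using side[of d] side[of "d - 1"] by (simp add: affine_normal_def add_diff_eq)
  have curvature: "affine_curvature P (k + d) = affine_curvature P (i + d)" for d
    using side[of d] normal[of d] normal[of "d + 1"] by (simp add: affine_curvature_def add.assoc)
  have node: "evolute_node P (k + d) = evolute_node P (i + d)" for d
    using P[of d] normal[of d] curvature[of d] by (simp add: evolute_node_def)
  have line: "normal_line P k = normal_line P i"
    using P[of 0] normal[of 0] by (simp add: normal_line_def parallel_def)
  show ?thesis
    using P[of 0] curvature[of "- 1"] curvature[of 0] node[of "- 1"] node[of 0] line
    by (simp add: evolute_edge_def Let_def cong: if_cong)
qed

text \<open>Membership in the whole evolute may come from an edge at another vertex, which says
  nothing about a cusp at \<open>i\<close>. The first part therefore concerns the edge at
  \<open>i\<close>, and the second excludes the other edges.\<close>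

theorem mainTheorem8:
  fixes P :: polygon and n :: nat and i j :: int and X :: "real ^ 2"
  assumes "convex_equal_area_polygon n P"
    and "adss_node n P i j X"
    and "\<not> adss_endpoint n P i j X"
  shows "(adss_cusp P i j X \<longleftrightarrow> X \<in> evolute_edge P i) \<and>
    ((\<forall>k. k mod int n \<noteq> i mod int n \<longrightarrow> X \<notin> evolute_edge P k) \<longrightarrow>
      (adss_cusp P i j X \<longleftrightarrow> X \<in> affine_evolute P))"
proof -
  obtain l where X: "X = parallel P l i" and "X \<in> parallel_edge P l j"
    using assms(2) unfolding adss_node_def by blast
  \<comment> \<open>The parameter of \<open>X\<close> on the normal line is unique, so the
    existential quantifier in \<open>adss_cusp\<close> can only pick \<open>l\<close>.\<close>
  then have "adss_cusp P i j X \<longleftrightarrow> parallel_cusp P l i"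
    unfolding adss_cusp_def using parallel_inject[OF assms(1)] by metis
  then have cusp: "adss_cusp P i j X \<longleftrightarrow> X \<in> evolute_edge P i"
    by (simp add: X parallel_cusp_iff_le[OF assms(1)] parallel_in_evolute_edge[OF assms(1)])
  have per: "P (k + int n) = P k" for k
    using assms(1) by (simp add: convex_equal_area_polygon_def simple_polygon_def)
  have "affine_evolute P = (\<Union>k. evolute_edge P k)"
    using evolute_node_in_edge[OF assms(1)] by (auto simp: affine_evolute_def)
  then have "X \<in> affine_evolute P \<longleftrightarrow> X \<in> evolute_edge P i"
    if "\<forall>k. k mod int n \<noteq> i mod int n \<longrightarrow> X \<notin> evolute_edge P k"
    using that evolute_edge_cong[of P, OF per] by blast
  with cusp show ?thesis by blast
qed

end
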